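(* Let $V$ be a finite-dimensional complex vector space and let $T:V\to V$ be a linear operator with $T^n=0$. For $m\ge 0$ let $K_m=\ker(T^m)$. A subset $B\subseteq V$ is a minimum-weight $q$-basis if and only if there exist subsets $I_m\subseteq K_m$ ($m=1,\dots,n$) such that $B=I_1\cup\cdots\cup I_n$ and $I_m$ represents a basis in $q(K_m)/q(K_{m-1})$ for all $m\in\{1,\dots,n\}$.
   Context: Let $q:V\to V/\operatorname{Im}(T)$ be the canonical projection. A $q$-basis is a subset $B\subseteq V$ that $q$ maps (bijectively) onto a basis of $V/\operatorname{Im}(T)$. For $v\in V$ let $\mathbf K(v)$ be the least nonnegative integer $m$ with $T^m v=0$. The weight of a finite set $B\subseteq V$ is $\sum_{b\in B}\mathbf K(b)$; a $q$-basis has minimum weight if its weight is minimal among all $q$-bases. A set $I_m\subseteq K_m$ represents a basis in $q(K_m)/q(K_{m-1})$ if the composite of $q|_{K_m}:K_m\to q(K_m)$ with the projection $q(K_m)\to q(K_m)/q(K_{m-1})$ maps $I_m$ (bijectively) onto a basis. *)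

theory Defs
  imports "HOL-Algebra.AbelCoset" "Jordan_Normal_Form.VS_Connect"
begin

text \<open>Complex vector spaces are records \<open>V :: (complex, 'v) module\<close> satisfying
  \<open>vectorspace class_ring V\<close>; the notions \<open>basis\<close>, \<open>fin_dim\<close>, \<open>linear_map\<close>, \<open>im\<close> and
  \<open>ker\<close> are those of the underlying vector space library.\<close>

text \<open>The quotient by a subspace \<open>W\<close>: its elements are the cosets \<open>W + v\<close>, added as sets.
  A scalar acts by \<open>c (W + v) = W + c v\<close>; taking the elementwise image of the coset would
  be wrong for \<open>c = 0\<close>. The ring fields \<open>mult\<close> and \<open>one\<close> of the record play no role.\<close>

definition quot_space :: "('a, 'v, 'c) module_scheme \<Rightarrow> 'v set \<Rightarrow> ('a, 'v set) module" where
  "quot_space V W =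
     \<lparr>carrier = a_rcosets\<^bsub>V\<^esub> W, mult = undefined, one = undefined, zero = W,
      add = set_add V, smult = (\<lambda>c X. \<Union>x\<in>X. W +>\<^bsub>V\<^esub> (c \<odot>\<^bsub>V\<^esub> x))\<rparr>"

lemma quot_space_simps:
  "carrier (quot_space V W) = a_rcosets\<^bsub>V\<^esub> W"
  "zero (quot_space V W) = W"
  "add (quot_space V W) = set_add V"
  "smult (quot_space V W) = (\<lambda>c X. \<Union>x\<in>X. W +>\<^bsub>V\<^esub> (c \<odot>\<^bsub>V\<^esub> x))"
  by (simp_all add: quot_space_def)

lemma submodule_abelian_subgroup:
  assumes "LinearCombinations.submodule K W V"
  shows "abelian_subgroup W V"
proof -
  interpret sm: LinearCombinations.submodule K W V by fact
  interpret Module.module K V by (rule sm.module)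
  show ?thesis
  proof (rule abelian_subgroupI3)
    show "additive_subgroup W V"
    proof (unfold additive_subgroup_def, rule subgroup.intro)
      fix x assume x: "x \<in> W"
      then have "\<ominus>\<^bsub>V\<^esub> x = (\<ominus>\<^bsub>K\<^esub> \<one>\<^bsub>K\<^esub>) \<odot>\<^bsub>V\<^esub> x"
        using sm.subset smult_minus_1 by auto
      with x have "\<ominus>\<^bsub>V\<^esub> x \<in> W" by simp
      then show "inv\<^bsub>add_monoid V\<^esub> x \<in> W" by (simp add: a_inv_def)
    qed (use sm.subset in auto)
  qed (rule M.abelian_group_axioms)
qed

lemma quot_space_smult:
  assumes "LinearCombinations.submodule K W V" "c \<in> carrier K" "v \<in> carrier V"
  shows "c \<odot>\<^bsub>quot_space V W\<^esub> (W +>\<^bsub>V\<^esub> v) = W +>\<^bsub>V\<^esub> (c \<odot>\<^bsub>V\<^esub> v)"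
proof -
  interpret sm: LinearCombinations.submodule K W V by fact
  interpret Module.module K V by (rule sm.module)
  interpret ab: abelian_subgroup W V by (rule submodule_abelian_subgroup) fact
  have "W +>\<^bsub>V\<^esub> (c \<odot>\<^bsub>V\<^esub> x) = W +>\<^bsub>V\<^esub> (c \<odot>\<^bsub>V\<^esub> v)" if "x \<in> W +>\<^bsub>V\<^esub> v" for x
  proof -
    from that obtain w where w: "w \<in> W" "x = w \<oplus>\<^bsub>V\<^esub> v" by (auto simp: a_r_coset_def')
    then have "c \<odot>\<^bsub>V\<^esub> x = (c \<odot>\<^bsub>V\<^esub> w) \<oplus>\<^bsub>V\<^esub> (c \<odot>\<^bsub>V\<^esub> v)"
      using sm.subset assms smult_r_distr[of c w v] by blast
    then have "c \<odot>\<^bsub>V\<^esub> x \<in> W +>\<^bsub>V\<^esub> (c \<odot>\<^bsub>V\<^esub> v)"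
      using w(1) assms unfolding a_r_coset_def' by blast
    then show ?thesis
      by (rule ab.a_repr_independence'[symmetric]) (use assms in simp)
  qed
  moreover have "v \<in> W +>\<^bsub>V\<^esub> v" using assms(3) by (rule ab.a_rcos_self)
  ultimately show ?thesis unfolding quot_space_simps by blast
qed

lemma quot_space_vectorspace:
  assumes "vectorspace K V" "LinearCombinations.submodule K W V"
  shows "vectorspace K (quot_space V W)"
proof -
  interpret vectorspace K V by fact
  interpret sm: LinearCombinations.submodule K W V by fact
  interpret ab: abelian_subgroup W V by (rule submodule_abelian_subgroup) fact
  note [simp] = quot_space_smult[OF assms(2)]
  have add: "(W +>\<^bsub>V\<^esub> u) \<oplus>\<^bsub>quot_space V W\<^esub> (W +>\<^bsub>V\<^esub> v) = W +>\<^bsub>V\<^esub> (u \<oplus>\<^bsub>V\<^esub> v)"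
    if "u \<in> carrier V" "v \<in> carrier V" for u v
    using that ab.a_rcos_sum by (simp add: quot_space_simps)
  have carr: "carrier (quot_space V W) = (\<lambda>v. W +>\<^bsub>V\<^esub> v) ` carrier V"
    by (auto simp: quot_space_simps A_RCOSETS_def')
  have zero: "\<zero>\<^bsub>quot_space V W\<^esub> = W +>\<^bsub>V\<^esub> \<zero>\<^bsub>V\<^esub>"
    using sm.subset by (force simp: quot_space_simps a_r_coset_def')
  have "abelian_group (quot_space V W)"
  proof (rule abelian_groupI)
    show "X \<oplus>\<^bsub>quot_space V W\<^esub> Y \<in> carrier (quot_space V W)" if "X \<in> carrier (quot_space V W)" "Y \<in> carrier (quot_space V W)" for X Y
      using that unfolding carr by (auto simp only: add intro!: imageI M.a_closed)
    show "\<zero>\<^bsub>quot_space V W\<^esub> \<in> carrier (quot_space V W)"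
      unfolding carr zero by (intro imageI M.zero_closed)
    show "X \<oplus>\<^bsub>quot_space V W\<^esub> Y \<oplus>\<^bsub>quot_space V W\<^esub> Z = X \<oplus>\<^bsub>quot_space V W\<^esub> (Y \<oplus>\<^bsub>quot_space V W\<^esub> Z)"
      if "X \<in> carrier (quot_space V W)" "Y \<in> carrier (quot_space V W)" "Z \<in> carrier (quot_space V W)" for X Y Z
      using that unfolding carr by (auto simp only: add M.a_closed M.a_assoc)
    show "X \<oplus>\<^bsub>quot_space V W\<^esub> Y = Y \<oplus>\<^bsub>quot_space V W\<^esub> X" if "X \<in> carrier (quot_space V W)" "Y \<in> carrier (quot_space V W)" for X Y
      using that unfolding carr by (auto simp only: add M.a_comm)
    show "\<zero>\<^bsub>quot_space V W\<^esub> \<oplus>\<^bsub>quot_space V W\<^esub> X = X" if "X \<in> carrier (quot_space V W)" for X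
      using that unfolding carr zero by (auto simp only: add M.zero_closed M.l_zero)
    show "\<exists>Y\<in>carrier (quot_space V W). Y \<oplus>\<^bsub>quot_space V W\<^esub> X = \<zero>\<^bsub>quot_space V W\<^esub>" if "X \<in> carrier (quot_space V W)" for X
    proof -
      from that obtain v where v: "v \<in> carrier V" "X = W +>\<^bsub>V\<^esub> v" unfolding carr by blast
      then have "(W +>\<^bsub>V\<^esub> (\<ominus>\<^bsub>V\<^esub> v)) \<oplus>\<^bsub>quot_space V W\<^esub> X = \<zero>\<^bsub>quot_space V W\<^esub>"
        by (simp only: add zero M.l_neg M.a_inv_closed)
      with v show ?thesis unfolding carr by blast
    qed
  qed
  moreover have "Module.module_axioms K (quot_space V W)"
    by (unfold_locales)
       (auto simp: carr add smult_l_distr smult_r_distr smult_assoc1)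
  ultimately show ?thesis
    by (simp add: vectorspace_def Module.module_def R.cring_axioms field_axioms)
qed

definition ker_pow :: "(complex, 'v) module \<Rightarrow> ('v \<Rightarrow> 'v) \<Rightarrow> nat \<Rightarrow> 'v set" where
  "ker_pow V T m = mod_hom.ker V V (T ^^ m)"

definition coker :: "(complex, 'v) module \<Rightarrow> ('v \<Rightarrow> 'v) \<Rightarrow> (complex, 'v set) module" where
  "coker V T = quot_space V (mod_hom.im V T)"

definition coker_proj :: "(complex, 'v) module \<Rightarrow> ('v \<Rightarrow> 'v) \<Rightarrow> 'v \<Rightarrow> 'v set" where
  "coker_proj V T v = mod_hom.im V T +>\<^bsub>V\<^esub> v"

definition maps_onto_basis ::
  "('v \<Rightarrow> 'w) \<Rightarrow> 'v set \<Rightarrow> (complex, 'w) module \<Rightarrow> bool" where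
  "maps_onto_basis f B Q \<longleftrightarrow> (\<exists>C. vectorspace.basis class_ring Q C \<and> bij_betw f B C)"

definition q_basis :: "(complex, 'v) module \<Rightarrow> ('v \<Rightarrow> 'v) \<Rightarrow> 'v set \<Rightarrow> bool" where
  "q_basis V T B \<longleftrightarrow> B \<subseteq> carrier V \<and> maps_onto_basis (coker_proj V T) B (coker V T)"

definition nil_height :: "(complex, 'v) module \<Rightarrow> ('v \<Rightarrow> 'v) \<Rightarrow> 'v \<Rightarrow> nat" where
  "nil_height V T v = (LEAST m. (T ^^ m) v = \<zero>\<^bsub>V\<^esub>)"

definition weight :: "(complex, 'v) module \<Rightarrow> ('v \<Rightarrow> 'v) \<Rightarrow> 'v set \<Rightarrow> nat" where
  "weight V T B = (\<Sum>b\<in>B. nil_height V T b)"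

text \<open>In a finite-dimensional space every \<open>q\<close>-basis is finite, so the junk value \<open>0\<close> of
  \<open>weight\<close> on infinite sets never enters the comparison.\<close>

definition min_weight_q_basis :: "(complex, 'v) module \<Rightarrow> ('v \<Rightarrow> 'v) \<Rightarrow> 'v set \<Rightarrow> bool" where
  "min_weight_q_basis V T B \<longleftrightarrow>
     q_basis V T B \<and> (\<forall>B'. q_basis V T B' \<longrightarrow> weight V T B \<le> weight V T B')"

text \<open>The subspace \<open>q(K\<^sub>m)\<close> of \<open>V / Im T\<close>, as a vector space; it contains \<open>q(K\<^sub>m\<^sub>-\<^sub>1)\<close>.\<close>

definition q_ker :: "(complex, 'v) module \<Rightarrow> ('v \<Rightarrow> 'v) \<Rightarrow> nat \<Rightarrow> (complex, 'v set) module" where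
  "q_ker V T m = (coker V T)\<lparr>carrier := coker_proj V T ` ker_pow V T m\<rparr>"

text \<open>Only used for \<open>m \<ge> 1\<close>.\<close>

definition represents_basis :: "(complex, 'v) module \<Rightarrow> ('v \<Rightarrow> 'v) \<Rightarrow> nat \<Rightarrow> 'v set \<Rightarrow> bool" where
  "represents_basis V T m I \<longleftrightarrow>
     I \<subseteq> ker_pow V T m \<and>
     maps_onto_basis
       (\<lambda>v. carrier (q_ker V T (m - 1)) +>\<^bsub>q_ker V T m\<^esub> coker_proj V T v) I
       (quot_space (q_ker V T m) (carrier (q_ker V T (m - 1))))"

end

theory Submission
  imports Defs
begin

text \<open>
  A finite family in a space of dimension \<open>r\<close> is a basis iff it spans and has \<open>r\<close> members, so
  everything reduces to spans and counting. Counting for each \<open>b\<close> the \<open>m < n\<close> with \<open>b \<in> K\<^sub>m\<close>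
  gives \<open>weight B + (\<Sum>m<n. |B \<inter> K\<^sub>m|) = n |B|\<close>. For a \<open>q\<close>-basis, \<open>q(B \<inter> K\<^sub>m)\<close> is linearly
  independent in \<open>q(K\<^sub>m)\<close>, hence \<open>|B \<inter> K\<^sub>m| \<le> dim q(K\<^sub>m)\<close>. A union of representatives of bases of the
  quotients \<open>q(K\<^sub>m) / q(K\<^sub>m\<^sub>-\<^sub>1)\<close> attains all these bounds, so the \<open>q\<close>-bases of minimum weight are
  those that attain all of them; conversely, equality for \<open>m\<close> and \<open>m - 1\<close> makes the elements of
  \<open>B\<close> in \<open>K\<^sub>m - K\<^sub>m\<^sub>-\<^sub>1\<close> represent a basis of \<open>q(K\<^sub>m) / q(K\<^sub>m\<^sub>-\<^sub>1)\<close>.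
\<close>

section \<open>Subspaces and spans under a linear map\<close>

lemma (in linear_map) image_submodule:
  assumes "LinearCombinations.submodule K N V"
  shows "LinearCombinations.submodule K (T ` N) W"
proof -
  interpret N: LinearCombinations.submodule K N V by fact
  have "T x \<oplus>\<^bsub>W\<^esub> T y \<in> T ` N" if "x \<in> N" "y \<in> N" for x y
    using that N.subset T_add[of x y] by (metis N.m_closed image_eqI subsetD)
  moreover have "c \<odot>\<^bsub>W\<^esub> T x \<in> T ` N" if "c \<in> carrier K" "x \<in> N" for c x
    using that N.subset T_smult[of c x] by (metis N.smult_closed image_eqI subsetD)
  moreover have "\<zero>\<^bsub>W\<^esub> \<in> T ` N"
    using T0_is_0 N.zero_closed by (metis image_eqI)
  ultimately show ?thesis
    using N.subset by unfold_locales auto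
qed

lemma (in linear_map) vimage_submodule:
  assumes "LinearCombinations.submodule K N W"
  shows "LinearCombinations.submodule K {v \<in> carrier V. T v \<in> N} V"
proof -
  interpret N: LinearCombinations.submodule K N W by fact
  show ?thesis by unfold_locales auto
qed

text \<open>Both inclusions come from the minimality of spans: images and preimages of subspaces are
  subspaces.\<close>

lemma (in linear_map) span_image:
  assumes "S \<subseteq> carrier V"
  shows "W.module.span (T ` S) = T ` V.module.span S"
proof
  have TS: "T ` S \<subseteq> carrier W" using assms by auto
  show "W.module.span (T ` S) \<subseteq> T ` V.module.span S"
    by (intro W.module.span_is_subset image_submodule V.module.span_is_submodule image_mono V.module.in_own_span assms)
  have "S \<subseteq> {v \<in> carrier V. T v \<in> W.module.span (T ` S)}"
    using W.module.in_own_span[OF TS] assms by auto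
  then have "V.module.span S \<subseteq> {v \<in> carrier V. T v \<in> W.module.span (T ` S)}"
    by (intro V.module.span_is_subset vimage_submodule W.module.span_is_submodule TS)
  then show "T ` V.module.span S \<subseteq> W.module.span (T ` S)" by auto
qed

section \<open>The projection onto a quotient, and dimensions\<close>

lemma quot_proj_linear:
  assumes "vectorspace K V" "LinearCombinations.submodule K W V"
  shows "linear_map K V (quot_space V W) (\<lambda>v. W +>\<^bsub>V\<^esub> v)"
proof -
  interpret V: vectorspace K V by fact
  interpret Q: vectorspace K "quot_space V W" by (rule quot_space_vectorspace[OF assms])
  interpret ab: abelian_subgroup W V by (rule submodule_abelian_subgroup) fact
  show ?thesis
  proof unfold_locales
    show "(\<lambda>v. W +>\<^bsub>V\<^esub> v) \<in> LinearCombinations.module_hom K V (quot_space V W)"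
      using quot_space_smult[OF assms(2)] ab.a_rcos_sum
      by (auto simp: LinearCombinations.module_hom_def quot_space_simps A_RCOSETS_def')
  qed
qed

lemma quot_proj_surj: "(\<lambda>v. W +>\<^bsub>V\<^esub> v) ` carrier V = carrier (quot_space V W)"
  by (auto simp: quot_space_simps A_RCOSETS_def')

lemma quot_proj_eq_iff:
  assumes "LinearCombinations.submodule K W V" "u \<in> carrier V" "v \<in> carrier V"
  shows "W +>\<^bsub>V\<^esub> u = W +>\<^bsub>V\<^esub> v \<longleftrightarrow> (\<exists>w\<in>W. u = w \<oplus>\<^bsub>V\<^esub> v)"
proof -
  interpret ab: abelian_subgroup W V by (rule submodule_abelian_subgroup) fact
  show ?thesis
    using ab.a_rcos_self[OF assms(2)] ab.a_repr_independence'[OF _ assms(3), of u]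
    by (auto simp: a_r_coset_def')
qed

lemma quot_proj_ker:
  assumes "LinearCombinations.submodule K W V"
  shows "{v \<in> carrier V. W +>\<^bsub>V\<^esub> v = \<zero>\<^bsub>quot_space V W\<^esub>} = W"
proof -
  interpret W: LinearCombinations.submodule K W V by fact
  interpret V: Module.module K V by (rule W.module)
  have *: "W +>\<^bsub>V\<^esub> \<zero>\<^bsub>V\<^esub> = W"
    using W.subset by (force simp: a_r_coset_def')
  have "W +>\<^bsub>V\<^esub> v = W \<longleftrightarrow> v \<in> W" if "v \<in> carrier V" for v
    using quot_proj_eq_iff[OF assms that V.zero_closed] W.subset unfolding * by force
  then show ?thesis using W.subset by (auto simp: quot_space_simps)
qed

text \<open>Rank-nullity for the projection, which is onto and has kernel \<open>W\<close>.\<close>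

lemma quot_space_dim:
  assumes "vectorspace K V" "vectorspace.fin_dim K V" "LinearCombinations.submodule K W V"
  shows "vectorspace.fin_dim K (quot_space V W)"
    and "vectorspace.dim K (quot_space V W) + vectorspace.dim K (V\<lparr>carrier := W\<rparr>) = vectorspace.dim K V"
proof -
  interpret V: vectorspace K V by fact
  interpret p: linear_map K V "quot_space V W" "\<lambda>v. W +>\<^bsub>V\<^esub> v"
    by (rule quot_proj_linear[OF assms(1,3)])
  show "vectorspace.fin_dim K (quot_space V W)"
    using p.rank_nullity_main(2)[OF assms(2) quot_proj_surj] .
  have "p.imT = carrier (quot_space V W)"
    by (simp add: p.im_def quot_proj_surj)
  then show "vectorspace.dim K (quot_space V W) + vectorspace.dim K (V\<lparr>carrier := W\<rparr>) = vectorspace.dim K V"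
    using p.rank_nullity[OF assms(2)] by (simp add: p.ker_def quot_proj_ker[OF assms(3)])
qed

text \<open>Independent subsets of \<open>W\<close> stay independent in \<open>V\<close>, so their
  sizes are bounded by \<open>dim\<close>. Hence one of them is maximal, and a maximal independent
  set generates \<open>W\<close>.\<close>

lemma (in vectorspace) subspace_fin_dim:
  assumes "fin_dim" "LinearCombinations.submodule K W V"
  shows "vectorspace.fin_dim K (vs W)"
proof -
  interpret W: vectorspace K "vs W"
    using assms subspace_is_vs[of W] vectorspace_axioms unfolding VectorSpace.subspace_def by auto
  have sub: "W \<subseteq> carrier V" using assms(2) by (rule LinearCombinations.submodule.subset)
  have P: "finite A \<and> card A \<le> dim" if "A \<subseteq> carrier (vs W) \<and> W.lin_indpt A" for A
    using that li_le_dim[OF assms(1), of A] span_li_not_depend(2)[of A W] assms(2) sub by auto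
  have "W.lin_indpt {}" by (simp add: W.lin_dep_def)
  then obtain A where "finite A" "maximal A (\<lambda>A. A \<subseteq> carrier (vs W) \<and> W.lin_indpt A)"
    using maximal_exists[of "\<lambda>A. A \<subseteq> carrier (vs W) \<and> W.lin_indpt A", OF P] by auto
  then show ?thesis
    using W.max_li_is_gen unfolding W.fin_dim_def maximal_def by blast
qed

text \<open>The projection kills \<open>W\<close>, so it maps the span of
  \<open>S \<union> W\<close> onto the span of the image of \<open>S\<close>. The span of
  \<open>S \<union> W\<close> contains \<open>W\<close>, hence is a union of cosets and is
  determined by its image.\<close>

lemma span_quot_eq_iff:
  assumes "vectorspace K V" "LinearCombinations.submodule K W V" "S \<subseteq> carrier V"
  shows "LinearCombinations.module.span K (quot_space V W) ((\<lambda>v. W +>\<^bsub>V\<^esub> v) ` S) = carrier (quot_space V W)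
    \<longleftrightarrow> LinearCombinations.module.span K V (S \<union> W) = carrier V"
proof -
  interpret p: linear_map K V "quot_space V W" "\<lambda>v. W +>\<^bsub>V\<^esub> v"
    by (rule quot_proj_linear[OF assms(1,2)])
  have W: "W \<subseteq> carrier V" using assms(2) by (rule LinearCombinations.submodule.subset)
  let ?p = "\<lambda>v. W +>\<^bsub>V\<^esub> v"
  have SW: "S \<union> W \<subseteq> carrier V" using W assms by auto
  have pS: "?p ` S \<subseteq> carrier (quot_space V W)"
    unfolding quot_proj_surj[symmetric] using assms(3) by auto
  have eq: "p.W.module.span (?p ` S) = ?p ` p.V.module.span (S \<union> W)"
  proof
    show "p.W.module.span (?p ` S) \<subseteq> ?p ` p.V.module.span (S \<union> W)"
      unfolding p.span_image[OF SW, symmetric] by (intro p.W.module.span_is_monotone) auto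
    have "?p w = \<zero>\<^bsub>quot_space V W\<^esub>" if "w \<in> W" for w
      using quot_proj_ker[OF assms(2)] that by blast
    then have "?p ` (S \<union> W) \<subseteq> p.W.module.span (?p ` S)"
      using p.W.module.in_own_span[OF pS] p.W.span_zero by auto
    then show "?p ` p.V.module.span (S \<union> W) \<subseteq> p.W.module.span (?p ` S)"
      unfolding p.span_image[OF SW, symmetric]
      by (intro p.W.module.span_is_subset p.W.module.span_is_submodule pS)
  qed
  show ?thesis
  proof
    assume gen: "p.W.module.span (?p ` S) = carrier (quot_space V W)"
    have "v \<in> p.V.module.span (S \<union> W)" if v: "v \<in> carrier V" for v
    proof -
      \<comment> \<open>A vector with the same coset as \<open>v\<close> is found in the span; it
        differs from \<open>v\<close> by an element of \<open>W\<close>, which the span contains as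
        well.\<close>
      obtain s where s: "s \<in> p.V.module.span (S \<union> W)" "?p v = ?p s"
        using gen v p.T_im unfolding eq by blast
      then have "s \<in> carrier V" using p.V.span_closed SW by blast
      then obtain w where "w \<in> W" "v = w \<oplus>\<^bsub>V\<^esub> s"
        using quot_proj_eq_iff[OF assms(2) v] s by blast
      then show ?thesis
        using p.V.span_add1[OF SW] s p.V.module.in_own_span[OF SW] by blast
    qed
    then show "p.V.module.span (S \<union> W) = carrier V"
      using p.V.module.span_is_subset2[OF SW] by blast
  next
    assume "p.V.module.span (S \<union> W) = carrier V"
    then show "p.W.module.span (?p ` S) = carrier (quot_space V W)"
      unfolding eq by (simp add: quot_proj_surj)
  qed
qed

section \<open>Bases recognized by span and cardinality\<close>

text \<open>Injectivity of \<open>f\<close> on \<open>B\<close> comes for free: a generating image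
  has at least dim Q elements, while \<open>B\<close> has exactly that many, so no two elements of
  \<open>B\<close> can collide.\<close>

lemma maps_onto_basis_iff:
  assumes "vectorspace class_ring Q" "vectorspace.fin_dim class_ring Q" "f ` B \<subseteq> carrier Q"
  shows "maps_onto_basis f B Q \<longleftrightarrow> finite B
    \<and> LinearCombinations.module.span class_ring Q (f ` B) = carrier Q
    \<and> card B = vectorspace.dim class_ring Q" (is "_ \<longleftrightarrow> ?R")
proof -
  interpret Q: vectorspace class_ring Q by fact
  show ?thesis
  proof
    assume "maps_onto_basis f B Q"
    then obtain C where C: "Q.basis C" "bij_betw f B C" by (auto simp: maps_onto_basis_def)
    then have fin: "finite C" using Q.li_le_dim(1)[OF assms(2)] by (auto simp: Q.basis_def)
    with C show ?R
      using Q.dim_basis[of C] bij_betw_finite[OF C(2)] bij_betw_same_card[OF C(2)]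
      by (auto simp: Q.basis_def bij_betw_def)
  next
    assume R: ?R
    then have "Q.dim \<le> card (f ` B)" using assms(3) by (intro Q.gen_ge_dim) auto
    moreover have "card (f ` B) \<le> card B" using R by (intro card_image_le) auto
    ultimately have *: "card (f ` B) = card B" using R by auto
    then have "inj_on f B" using R by (intro eq_card_imp_inj_on) auto
    moreover have "Q.basis (f ` B)"
      using R * assms(3) by (intro Q.dim_gen_is_basis) auto
    ultimately show "maps_onto_basis f B Q"
      by (auto simp: maps_onto_basis_def bij_betw_def)
  qed
qed

text \<open>Expresses a basis of the quotient U/W by spans and dimensions inside the ambient space
  \<open>Q\<close> alone, so that different subspaces \<open>U\<close> and \<open>W\<close> of a
  filtration can be compared.\<close>

lemma maps_onto_basis_quot_iff:
  fixes Q :: "(complex, 'w) module"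
  assumes "vectorspace class_ring Q" "vectorspace.fin_dim class_ring Q"
    and "LinearCombinations.submodule class_ring U Q" "LinearCombinations.submodule class_ring W Q"
    and "W \<subseteq> U" "f ` I \<subseteq> U"
  shows "maps_onto_basis (\<lambda>v. W +>\<^bsub>Q\<lparr>carrier := U\<rparr>\<^esub> f v) I (quot_space (Q\<lparr>carrier := U\<rparr>) W) \<longleftrightarrow> finite I
    \<and> LinearCombinations.module.span class_ring Q (f ` I \<union> W) = U
    \<and> card I + vectorspace.dim class_ring (Q\<lparr>carrier := W\<rparr>) = vectorspace.dim class_ring (Q\<lparr>carrier := U\<rparr>)"
proof -
  interpret Q: vectorspace class_ring Q by fact
  let ?U = "Q\<lparr>carrier := U\<rparr>"
  interpret U: vectorspace class_ring ?U
    using Q.subspace_is_vs[of U] assms(1,3) by (auto simp: VectorSpace.subspace_def)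
  have WU: "LinearCombinations.submodule class_ring W ?U"
    using assms(4,5) U.module_axioms
    by (auto simp: LinearCombinations.submodule_def)
  have fU: "vectorspace.fin_dim class_ring ?U"
    by (rule Q.subspace_fin_dim[OF assms(2,3)])
  note dim = quot_space_dim[OF U.vectorspace_axioms fU WU]
  have im: "(\<lambda>v. W +>\<^bsub>?U\<^esub> f v) ` I = (\<lambda>v. W +>\<^bsub>?U\<^esub> v) ` f ` I" by auto
  have sub: "f ` I \<subseteq> carrier ?U" using assms(6) by simp
  \<comment> \<open>Spans taken in the subspace \<open>U\<close> and in \<open>Q\<close> agree,
    since all the vectors lie in \<open>U\<close>.\<close>
  have "U.span (f ` I \<union> W) = Q.span (f ` I \<union> W)"
    using assms(5,6) by (intro Q.span_li_not_depend assms(3)) auto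
  then have gen: "LinearCombinations.module.span class_ring (quot_space ?U W) ((\<lambda>v. W +>\<^bsub>?U\<^esub> f v) ` I)
      = carrier (quot_space ?U W) \<longleftrightarrow> Q.span (f ` I \<union> W) = U"
    using span_quot_eq_iff[OF U.vectorspace_axioms WU sub] unfolding im by simp
  have dim': "vectorspace.dim class_ring (quot_space ?U W) + vectorspace.dim class_ring (Q\<lparr>carrier := W\<rparr>) = U.dim"
    using dim(2) by simp
  have fI: "(\<lambda>v. W +>\<^bsub>?U\<^esub> f v) ` I \<subseteq> carrier (quot_space ?U W)"
    unfolding im using sub quot_proj_surj[of ?U W] by blast
  show ?thesis
    unfolding maps_onto_basis_iff[OF quot_space_vectorspace[OF U.vectorspace_axioms WU] dim(1) fI] gen
      dim'[symmetric] by simp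
qed

lemma (in vectorspace) subspace_dim_le_card:
  assumes "LinearCombinations.submodule K W V" "finite S" "S \<subseteq> carrier V" "span S = W"
  shows "vectorspace.dim K (vs W) \<le> card S"
proof -
  interpret W: vectorspace K "vs W"
    using assms(1) subspace_is_vs[of W] vectorspace_axioms unfolding VectorSpace.subspace_def by auto
  have "S \<subseteq> W" using in_own_span[OF assms(3)] assms(4) by simp
  then show ?thesis
    using assms span_li_not_depend(1)[of S W] by (intro W.gen_ge_dim) auto
qed

lemma (in vectorspace) subspace_lin_indpt_card:
  assumes "fin_dim" "LinearCombinations.submodule K W V" "S \<subseteq> W" "lin_indpt S"
  shows "card S \<le> vectorspace.dim K (vs W)"
    and "vectorspace.dim K (vs W) \<le> card S \<Longrightarrow> span S = W"
proof -
  interpret W: vectorspace K "vs W"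
    using assms(2) subspace_is_vs[of W] vectorspace_axioms unfolding VectorSpace.subspace_def by auto
  note fd = subspace_fin_dim[OF assms(1,2)]
  have li: "W.lin_indpt S" using span_li_not_depend(2)[OF assms(3,2)] assms(4) by simp
  have S: "S \<subseteq> carrier (vs W)" using assms(3) by simp
  show "card S \<le> W.dim" by (rule W.li_le_dim[OF fd S li])
  assume "W.dim \<le> card S"
  then have "W.basis S" using W.dim_li_is_basis fd S li W.li_le_dim(1) by blast
  then show "span S = W"
    using span_li_not_depend(1)[OF assms(3,2)] by (simp add: W.basis_def)
qed

section \<open>The nilpotent operator and the filtration of its cokernel\<close>

lemma linear_map_funpow:
  assumes "linear_map K V V T"
  shows "linear_map K V V (T ^^ m)"
proof -
  interpret linear_map K V V T by fact
  have "T ^^ m \<in> LinearCombinations.module_hom K V V"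
    by (induction m) (auto simp: LinearCombinations.module_hom_def Pi_iff)
  then show ?thesis by unfold_locales
qed

locale nilpotent_operator =
  fixes V :: "(complex, 'v) module" and T :: "'v \<Rightarrow> 'v" and n :: nat
  assumes linear: "linear_map class_ring V V T"
    and fin_dim: "vectorspace.fin_dim class_ring V"
    and nilpotent: "v \<in> carrier V \<Longrightarrow> (T ^^ n) v = \<zero>\<^bsub>V\<^esub>"
begin

lemma vectorspace_V: "vectorspace class_ring V"
  using linear by (rule linear_map.axioms(1))

lemma im_submodule: "LinearCombinations.submodule class_ring (mod_hom.im V T) V"
proof -
  interpret linear_map class_ring V V T by (rule linear)
  show ?thesis by (rule im_is_submodule)
qed

lemma ker_pow_submodule: "LinearCombinations.submodule class_ring (ker_pow V T m) V"
proof -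
  interpret linear_map class_ring V V "T ^^ m" by (rule linear_map_funpow[OF linear])
  show ?thesis unfolding ker_pow_def by (rule ker_is_submodule)
qed

lemma ker_pow_iff: "v \<in> ker_pow V T m \<longleftrightarrow> v \<in> carrier V \<and> (T ^^ m) v = \<zero>\<^bsub>V\<^esub>"
proof -
  interpret linear_map class_ring V V "T ^^ m" by (rule linear_map_funpow[OF linear])
  show ?thesis unfolding ker_pow_def by (simp add: ker_def)
qed

sublocale V: vectorspace class_ring V by (rule vectorspace_V)

sublocale Q: vectorspace class_ring "coker V T"
  unfolding coker_def by (rule quot_space_vectorspace[OF vectorspace_V im_submodule])

sublocale q: linear_map class_ring V "coker V T" "coker_proj V T"
  using quot_proj_linear[OF vectorspace_V im_submodule] unfolding coker_def coker_proj_def[abs_def] .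

lemma q_surj: "coker_proj V T ` carrier V = carrier (coker V T)"
  unfolding coker_def coker_proj_def[abs_def] by (rule quot_proj_surj)

lemma Q_fin_dim: "Q.fin_dim"
  using q.rank_nullity_main(2)[OF fin_dim q_surj] .

lemma ker_pow_subset: "ker_pow V T m \<subseteq> carrier V"
  by (auto simp: ker_pow_iff)

lemma ker_pow_mono:
  assumes "m \<le> k"
  shows "ker_pow V T m \<subseteq> ker_pow V T k"
proof -
  interpret linear_map class_ring V V "T ^^ (k - m)" by (rule linear_map_funpow[OF linear])
  have "(T ^^ k) v = (T ^^ (k - m)) ((T ^^ m) v)" for v
    using assms funpow_add[of "k - m" m T] by simp
  then show ?thesis by (auto simp: ker_pow_iff T0_is_0)
qed

lemma ker_pow_top: "ker_pow V T n = carrier V"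
  using nilpotent by (auto simp: ker_pow_iff)

lemma ker_pow_0: "ker_pow V T 0 = {\<zero>\<^bsub>V\<^esub>}"
  by (auto simp: ker_pow_iff)

text \<open>The carrier of \<open>q_ker V T m\<close>. These subspaces increase from zero at
  \<open>m = 0\<close> to the whole cokernel at \<open>m = n\<close>.\<close>

definition q_level :: "nat \<Rightarrow> 'v set set" where
  "q_level m = coker_proj V T ` ker_pow V T m"

definition level_dim :: "nat \<Rightarrow> nat" where
  "level_dim m = vectorspace.dim class_ring (coker V T\<lparr>carrier := q_level m\<rparr>)"

lemma q_level_submodule: "LinearCombinations.submodule class_ring (q_level m) (coker V T)"
  unfolding q_level_def by (rule q.image_submodule[OF ker_pow_submodule])

lemma q_level_mono: "m \<le> k \<Longrightarrow> q_level m \<subseteq> q_level k"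
  unfolding q_level_def by (intro image_mono ker_pow_mono)

lemma q_level_top: "q_level n = carrier (coker V T)"
  by (simp add: q_level_def ker_pow_top q_surj)

lemma level_dim_top: "level_dim n = Q.dim"
  by (simp add: level_dim_def q_level_top)

lemma q_level_0: "q_level 0 = {\<zero>\<^bsub>coker V T\<^esub>}"
  by (simp add: q_level_def ker_pow_0 q.T0_is_0)

lemma level_dim_0: "level_dim 0 = 0"
proof -
  have "Q.span {} = q_level 0" unfolding q_level_0 by (rule Q.span_empty)
  then show ?thesis
    using Q.subspace_dim_le_card[OF q_level_submodule[of 0], of "{}"] by (simp add: level_dim_def)
qed

section \<open>Both notions of basis in terms of the filtration\<close>

lemma q_basis_iff:
  "q_basis V T B \<longleftrightarrow> finite B \<and> B \<subseteq> carrier V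
    \<and> Q.span (coker_proj V T ` B) = carrier (coker V T) \<and> card B = level_dim n"
proof (cases "B \<subseteq> carrier V")
  case True
  then have "coker_proj V T ` B \<subseteq> carrier (coker V T)" by auto
  then show ?thesis
    using maps_onto_basis_iff[OF Q.vectorspace_axioms Q_fin_dim] True
    unfolding q_basis_def level_dim_top by blast
qed (simp add: q_basis_def)

lemma represents_basis_iff:
  "represents_basis V T m I \<longleftrightarrow> finite I \<and> I \<subseteq> ker_pow V T m
    \<and> Q.span (coker_proj V T ` I \<union> q_level (m - 1)) = q_level m \<and> card I + level_dim (m - 1) = level_dim m"
proof (cases "I \<subseteq> ker_pow V T m")
  case True
  then have "coker_proj V T ` I \<subseteq> q_level m" by (auto simp: q_level_def)
  then show ?thesis
    using maps_onto_basis_quot_iff[OF Q.vectorspace_axioms Q_fin_dim q_level_submodule q_level_submodule q_level_mono[of "m - 1" m]]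
      True
    unfolding represents_basis_def q_ker_def level_dim_def by (simp add: q_level_def[symmetric])
qed (simp add: represents_basis_def)

section \<open>Weight as a count of kernel memberships\<close>

text \<open>\<open>v\<close> lies in K_m exactly when its height is at most \<open>m\<close>, so the
  indices counted are those from the height up to \<open>n - 1\<close>. The additive form avoids
  truncated subtraction.\<close>

lemma nil_height_eq:
  assumes "v \<in> carrier V"
  shows "nil_height V T v + (\<Sum>m<n. of_bool (v \<in> ker_pow V T m)) = n"
proof -
  let ?h = "nil_height V T v"
  have Th: "v \<in> ker_pow V T ?h" and hn: "?h \<le> n"
    using LeastI[of "\<lambda>m. (T ^^ m) v = \<zero>\<^bsub>V\<^esub>" n] Least_le[of "\<lambda>m. (T ^^ m) v = \<zero>\<^bsub>V\<^esub>" n]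
      nilpotent[OF assms] assms by (auto simp: nil_height_def ker_pow_iff)
  have "v \<in> ker_pow V T m \<longleftrightarrow> ?h \<le> m" for m
  proof
    assume "v \<in> ker_pow V T m"
    then show "?h \<le> m" unfolding nil_height_def ker_pow_iff by (intro Least_le) simp
  next
    assume "?h \<le> m"
    then show "v \<in> ker_pow V T m" using ker_pow_mono Th by (meson subsetD)
  qed
  then have "(\<Sum>m<n. of_bool (v \<in> ker_pow V T m)) = card ({..<n} \<inter> {m. ?h \<le> m})"
    by (simp add: of_bool_def sum.If_cases)
  also have "{..<n} \<inter> {m. ?h \<le> m} = {?h..<n}" by auto
  finally show ?thesis using hn by simp
qed

text \<open>The previous identity summed over \<open>B\<close>, with the order of the two summations
  exchanged.\<close>

lemma weight_eq:
  assumes "finite B" "B \<subseteq> carrier V"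
  shows "weight V T B + (\<Sum>m<n. card (B \<inter> ker_pow V T m)) = n * card B"
proof -
  have "card (B \<inter> ker_pow V T m) = (\<Sum>b\<in>B. of_bool (b \<in> ker_pow V T m))" for m
    using assms(1) by (simp add: of_bool_def sum.If_cases)
  then have "(\<Sum>m<n. card (B \<inter> ker_pow V T m)) = (\<Sum>b\<in>B. \<Sum>m<n. of_bool (b \<in> ker_pow V T m))"
    by (simp only: sum.swap[of _ B])
  then have "weight V T B + (\<Sum>m<n. card (B \<inter> ker_pow V T m))
    = (\<Sum>b\<in>B. nil_height V T b + (\<Sum>m<n. of_bool (b \<in> ker_pow V T m)))"
    by (simp add: weight_def sum.distrib)
  also have "\<dots> = (\<Sum>b\<in>B. n)"
    using assms(2) nil_height_eq by (intro sum.cong) auto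
  finally show ?thesis by simp
qed

text \<open>Part of a basis is independent, which bounds its size by the dimension of the subspace
  containing it; if the bound is attained, that part spans the subspace.\<close>

lemma q_basis_Int_ker_pow:
  assumes "q_basis V T B"
  shows "card (B \<inter> ker_pow V T m) \<le> level_dim m"
    and "level_dim m \<le> card (B \<inter> ker_pow V T m) \<Longrightarrow> Q.span (coker_proj V T ` (B \<inter> ker_pow V T m)) = q_level m"
proof -
  from assms obtain C where C: "Q.basis C" "bij_betw (coker_proj V T) B C"
    by (auto simp: q_basis_def maps_onto_basis_def)
  let ?S = "coker_proj V T ` (B \<inter> ker_pow V T m)"
  have "?S \<subseteq> C" using C(2) by (auto simp: bij_betw_def)
  then have li: "Q.lin_indpt ?S"
    using C(1) Q.subset_li_is_li by (auto simp: Q.basis_def)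
  have sub: "?S \<subseteq> q_level m" by (auto simp: q_level_def)
  have "inj_on (coker_proj V T) (B \<inter> ker_pow V T m)"
    using C(2) by (auto simp: bij_betw_def intro: inj_on_subset)
  then have "card ?S = card (B \<inter> ker_pow V T m)" by (rule card_image)
  then show "card (B \<inter> ker_pow V T m) \<le> level_dim m"
    and "level_dim m \<le> card (B \<inter> ker_pow V T m) \<Longrightarrow> Q.span ?S = q_level m"
    using Q.subspace_lin_indpt_card[OF Q_fin_dim q_level_submodule sub li] by (simp_all add: level_dim_def)
qed

section \<open>Families of representatives\<close>

text \<open>Needed to show that the lower bound on the weight is attained by some
  \<open>q\<close>-basis.\<close>

lemma represents_basis_exists:
  assumes "m \<ge> 1"
  shows "\<exists>I. represents_basis V T m I"
proof -
  let ?U = "q_ker V T m" and ?W = "carrier (q_ker V T (m - 1))"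
  have W: "?W = q_level (m - 1)" by (simp add: q_ker_def q_level_def)
  have U: "?U = coker V T\<lparr>carrier := q_level m\<rparr>" by (simp add: q_ker_def q_level_def)
  interpret U: vectorspace class_ring ?U
    unfolding U using Q.subspace_is_vs[of "q_level m"] Q.vectorspace_axioms q_level_submodule
    by (auto simp: VectorSpace.subspace_def)
  have WU: "LinearCombinations.submodule class_ring ?W ?U"
    using q_level_submodule[of "m - 1"] q_level_mono[of "m - 1" m] U.module_axioms unfolding W U
    by (auto simp: LinearCombinations.submodule_def)
  have fU: "U.fin_dim"
    unfolding U by (rule Q.subspace_fin_dim[OF Q_fin_dim q_level_submodule])
  interpret R: vectorspace class_ring "quot_space ?U ?W"
    by (rule quot_space_vectorspace[OF U.vectorspace_axioms WU])
  obtain C where C: "R.basis C"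
    using R.finite_basis_exists quot_space_dim(1)[OF U.vectorspace_axioms fU WU] by blast
  let ?f = "\<lambda>v. ?W +>\<^bsub>?U\<^esub> coker_proj V T v"
  have "?f ` ker_pow V T m = carrier (quot_space ?U ?W)"
    unfolding quot_proj_surj[symmetric] by (auto simp: U q_level_def)
  moreover have "C \<subseteq> carrier (quot_space ?U ?W)" using C unfolding R.basis_def by blast
  ultimately have "C \<subseteq> ?f ` ker_pow V T m" by simp
  \<comment> \<open>One preimage in K_m is chosen for each element of \<open>C\<close>, which makes
    the map injective on \<open>I\<close>.\<close>
  then obtain I where "I \<subseteq> ker_pow V T m" "inj_on ?f I" "C = ?f ` I"
    by (auto simp: subset_image_inj)
  with C have "represents_basis V T m I"
    by (auto simp: represents_basis_def maps_onto_basis_def bij_betw_def)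
  then show ?thesis ..
qed

text \<open>By induction the union spans q(K_m), so it has at least \<open>level_dim m\<close>
  elements; adding up the sizes of the \<open>I k\<close> bounds it by the same number. The
  \<open>I k\<close> are not assumed disjoint.\<close>

lemma represents_basis_Union:
  assumes "\<And>m. m \<in> {1..n} \<Longrightarrow> represents_basis V T m (I m)" and "m \<le> n"
  shows "finite (\<Union>k\<in>{1..m}. I k)" "(\<Union>k\<in>{1..m}. I k) \<subseteq> ker_pow V T m"
    "Q.span (coker_proj V T ` (\<Union>k\<in>{1..m}. I k)) = q_level m" "card (\<Union>k\<in>{1..m}. I k) = level_dim m"
proof -
  have "finite (\<Union>k\<in>{1..m}. I k) \<and> (\<Union>k\<in>{1..m}. I k) \<subseteq> ker_pow V T m
    \<and> Q.span (coker_proj V T ` (\<Union>k\<in>{1..m}. I k)) = q_level m \<and> card (\<Union>k\<in>{1..m}. I k) = level_dim m"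
    using assms(2)
  proof (induction m)
    case 0
    show ?case using Q.span_empty by (simp add: q_level_0 level_dim_0)
  next
    case (Suc m)
    let ?B = "\<Union>k\<in>{1..m}. I k" and ?B' = "\<Union>k\<in>{1..Suc m}. I k"
    have B': "?B' = I (Suc m) \<union> ?B" by (simp add: atLeastAtMostSuc_conv)
    from assms(1)[of "Suc m"] Suc.prems
    have I: "finite (I (Suc m))" "I (Suc m) \<subseteq> ker_pow V T (Suc m)"
      "Q.span (coker_proj V T ` I (Suc m) \<union> q_level m) = q_level (Suc m)" "card (I (Suc m)) + level_dim m = level_dim (Suc m)"
      by (auto simp: represents_basis_iff)
    have fin: "finite ?B'" and sub: "?B' \<subseteq> ker_pow V T (Suc m)"
      using I Suc ker_pow_mono[of m "Suc m"] unfolding B' by auto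
    have qB': "coker_proj V T ` ?B' \<subseteq> carrier (coker V T)"
      unfolding q_surj[symmetric] using sub ker_pow_subset[of "Suc m"] by (intro image_mono) blast
    have span: "Q.span (coker_proj V T ` ?B') = q_level (Suc m)"
    proof
      show "Q.span (coker_proj V T ` ?B') \<subseteq> q_level (Suc m)"
        using sub by (intro Q.span_is_subset q_level_submodule) (auto simp: q_level_def)
      \<comment> \<open>The sets up to \<open>m\<close> already span q(K_m), so the representatives
        at \<open>Suc m\<close> only have to generate q(K_(m+1)) modulo q(K_m).\<close>
      have "q_level m \<subseteq> Q.span (coker_proj V T ` ?B')"
        using Suc Q.span_is_monotone[of "coker_proj V T ` ?B" "coker_proj V T ` ?B'"] unfolding B' by auto
      moreover have "coker_proj V T ` I (Suc m) \<subseteq> Q.span (coker_proj V T ` ?B')"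
        using Q.in_own_span[OF qB'] unfolding B' by auto
      ultimately show "q_level (Suc m) \<subseteq> Q.span (coker_proj V T ` ?B')"
        unfolding I(3)[symmetric] by (intro Q.span_is_subset Q.span_is_submodule qB') auto
    qed
    have "level_dim (Suc m) \<le> card (coker_proj V T ` ?B')"
      unfolding level_dim_def using fin by (intro Q.subspace_dim_le_card q_level_submodule qB' span) auto
    also have "\<dots> \<le> card ?B'" using fin by (rule card_image_le)
    finally have "level_dim (Suc m) \<le> card ?B'" .
    moreover have "card ?B' \<le> level_dim (Suc m)"
      using card_Un_le[of "I (Suc m)" ?B] I(4) Suc unfolding B' by simp
    ultimately show ?case using fin sub span by simp
  qed
  then show "finite (\<Union>k\<in>{1..m}. I k)" "(\<Union>k\<in>{1..m}. I k) \<subseteq> ker_pow V T m"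
    "Q.span (coker_proj V T ` (\<Union>k\<in>{1..m}. I k)) = q_level m" "card (\<Union>k\<in>{1..m}. I k) = level_dim m"
    by auto
qed

text \<open>The sets \<open>I k\<close> with \<open>k \<le> m\<close> all lie in K_m and together
  have \<open>level_dim m\<close> elements, so the upper bound for a \<open>q\<close>-basis is
  reached at each \<open>m\<close>.\<close>

lemma represents_basis_family:
  assumes "\<And>m. m \<in> {1..n} \<Longrightarrow> represents_basis V T m (I m)" and B: "B = (\<Union>m\<in>{1..n}. I m)"
  shows "q_basis V T B" and "m \<le> n \<Longrightarrow> card (B \<inter> ker_pow V T m) = level_dim m"
proof -
  note U = represents_basis_Union[of I, OF assms(1)]
  show qb: "q_basis V T B"
    using U[of n] subset_trans[OF U(2)[of n] ker_pow_subset] unfolding q_basis_iff B q_level_top by simp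
  assume m: "m \<le> n"
  have "finite B" using qb by (simp add: q_basis_iff)
  moreover have "(\<Union>k\<in>{1..m}. I k) \<subseteq> B \<inter> ker_pow V T m"
    using U(2)[OF _ m] m unfolding B by fastforce
  ultimately have "level_dim m \<le> card (B \<inter> ker_pow V T m)"
    using U(4)[OF _ m] card_mono[of "B \<inter> ker_pow V T m" "\<Union>k\<in>{1..m}. I k"] by auto
  then show "card (B \<inter> ker_pow V T m) = level_dim m"
    using q_basis_Int_ker_pow(1)[OF qb, of m] by simp
qed

section \<open>The minimum of the weight\<close>

lemma weight_ge:
  assumes "q_basis V T B"
  shows "n * level_dim n \<le> weight V T B + (\<Sum>m<n. level_dim m)"
    and "weight V T B + (\<Sum>m<n. level_dim m) = n * level_dim n \<longleftrightarrow> (\<forall>m<n. card (B \<inter> ker_pow V T m) = level_dim m)"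
proof -
  have eq: "weight V T B + (\<Sum>m<n. card (B \<inter> ker_pow V T m)) = n * level_dim n"
    using weight_eq[of B] assms by (simp add: q_basis_iff)
  have le: "card (B \<inter> ker_pow V T m) \<le> level_dim m" for m
    by (rule q_basis_Int_ker_pow(1)[OF assms])
  have "(\<Sum>m<n. card (B \<inter> ker_pow V T m)) \<le> (\<Sum>m<n. level_dim m)"
    using le by (rule sum_mono)
  with eq show "n * level_dim n \<le> weight V T B + (\<Sum>m<n. level_dim m)" by simp
  have "(\<Sum>m<n. card (B \<inter> ker_pow V T m)) = (\<Sum>m<n. level_dim m) \<longleftrightarrow> (\<forall>m<n. card (B \<inter> ker_pow V T m) = level_dim m)"
  proof
    \<comment> \<open>Termwise inequalities between two equal sums must all be equalities.\<close>
    assume "(\<Sum>m<n. card (B \<inter> ker_pow V T m)) = (\<Sum>m<n. level_dim m)"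
    then show "\<forall>m<n. card (B \<inter> ker_pow V T m) = level_dim m"
      by (intro allI impI sum_mono_inv[OF _ le, where I = "{..<n}"]) simp_all
  qed (intro sum.cong, simp_all)
  with eq show "weight V T B + (\<Sum>m<n. level_dim m) = n * level_dim n \<longleftrightarrow> (\<forall>m<n. card (B \<inter> ker_pow V T m) = level_dim m)"
    by auto
qed

text \<open>A union \<open>B'\<close> of representatives attains the lower bound of
  \<open>weight_ge\<close>, so having minimum weight means attaining that bound.\<close>

lemma min_weight_iff:
  "min_weight_q_basis V T B \<longleftrightarrow> q_basis V T B \<and> (\<forall>m<n. card (B \<inter> ker_pow V T m) = level_dim m)"
proof -
  have "\<forall>m\<in>{1..n}. \<exists>I. represents_basis V T m I"
    using represents_basis_exists by auto
  then obtain I where I: "\<And>m. m \<in> {1..n} \<Longrightarrow> represents_basis V T m (I m)"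
    by metis
  define B' where "B' = (\<Union>m\<in>{1..n}. I m)"
  have "q_basis V T B'" "weight V T B' + (\<Sum>m<n. level_dim m) = n * level_dim n"
    using represents_basis_family[OF I B'_def] weight_ge(2) by auto
  then show ?thesis
    using weight_ge unfolding min_weight_q_basis_def
    by (metis add_le_cancel_right antisym)
qed

section \<open>Recovering representatives from a set of minimum weight\<close>

text \<open>The difference of the equalities at \<open>m\<close> and \<open>m - 1\<close> gives the
  right number of elements. The elements of \<open>B\<close> in K_m span q(K_m), and those among
  them in K_(m-1) are absorbed by q(K_(m-1)).\<close>

lemma represents_basis_layer:
  assumes B: "q_basis V T B" and d: "\<And>m. m \<le> n \<Longrightarrow> card (B \<inter> ker_pow V T m) = level_dim m"
    and m: "1 \<le> m" "m \<le> n"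
  shows "represents_basis V T m (B \<inter> ker_pow V T m - ker_pow V T (m - 1))"
proof -
  let ?I = "B \<inter> ker_pow V T m - ker_pow V T (m - 1)"
  have fin: "finite B" using B by (simp add: q_basis_iff)
  have K: "ker_pow V T (m - 1) \<subseteq> ker_pow V T m" by (rule ker_pow_mono) simp
  have BI: "B \<inter> ker_pow V T m = ?I \<union> (B \<inter> ker_pow V T (m - 1))" using K by auto
  have "level_dim m = card ?I + level_dim (m - 1)"
    using d[of m] d[of "m - 1"] m fin arg_cong[OF BI, of card]
      card_Un_disjoint[of ?I "B \<inter> ker_pow V T (m - 1)"] by fastforce
  moreover have "Q.span (coker_proj V T ` ?I \<union> q_level (m - 1)) = q_level m"
  proof
    have qI: "coker_proj V T ` ?I \<subseteq> q_level m" by (auto simp: q_level_def)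
    then show "Q.span (coker_proj V T ` ?I \<union> q_level (m - 1)) \<subseteq> q_level m"
      using q_level_mono[of "m - 1" m] by (intro Q.span_is_subset q_level_submodule) auto
    have "coker_proj V T ` (B \<inter> ker_pow V T m) \<subseteq> coker_proj V T ` ?I \<union> q_level (m - 1)"
      unfolding q_level_def by blast
    then have "Q.span (coker_proj V T ` (B \<inter> ker_pow V T m)) \<subseteq> Q.span (coker_proj V T ` ?I \<union> q_level (m - 1))"
      by (rule Q.span_is_monotone)
    then show "q_level m \<subseteq> Q.span (coker_proj V T ` ?I \<union> q_level (m - 1))"
      using q_basis_Int_ker_pow(2)[OF B, of m] d[OF m(2)] by simp
  qed
  ultimately show ?thesis using fin by (auto simp: represents_basis_iff)
qed

text \<open>Each \<open>b\<close> belongs to the layer indexed by its height. The second hypothesis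
  excludes the zero vector, which has height 0 and lies in no layer.\<close>

lemma layers_Union:
  assumes "B \<subseteq> carrier V" "B \<inter> ker_pow V T 0 = {}"
  shows "B = (\<Union>m\<in>{1..n}. B \<inter> ker_pow V T m - ker_pow V T (m - 1))"
proof
  show "B \<subseteq> (\<Union>m\<in>{1..n}. B \<inter> ker_pow V T m - ker_pow V T (m - 1))"
  proof
    fix b assume b: "b \<in> B"
    define h where "h = (LEAST m. b \<in> ker_pow V T m)"
    have bn: "b \<in> ker_pow V T n" using b assms(1) ker_pow_top by auto
    have h: "b \<in> ker_pow V T h" "h \<le> n"
      unfolding h_def using bn by (auto intro: LeastI Least_le)
    \<comment> \<open>For \<open>h = 0\<close> the truncated \<open>h - 1\<close> would be
      \<open>h\<close> itself, and minimality would say nothing about K_(h-1).\<close>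
    then have "h \<noteq> 0" using b assms(2) by (metis IntI empty_iff)
    moreover from this have "b \<notin> ker_pow V T (h - 1)"
      unfolding h_def by (intro not_less_Least) simp
    ultimately show "b \<in> (\<Union>m\<in>{1..n}. B \<inter> ker_pow V T m - ker_pow V T (m - 1))"
      using b h by (intro UN_I[of h]) auto
  qed
qed blast

end

section \<open>The characterization of minimum-weight \<open>q\<close>-bases\<close>

theorem corollary1p0p3:
  fixes V :: "(complex, 'v) module" and T :: "'v \<Rightarrow> 'v" and n :: nat and B :: "'v set"
  assumes "vectorspace class_ring V"
    and "vectorspace.fin_dim class_ring V"
    and "linear_map class_ring V V T"
    and "\<forall>v\<in>carrier V. (T ^^ n) v = \<zero>\<^bsub>V\<^esub>"
    and "B \<subseteq> carrier V"
  shows "min_weight_q_basis V T B \<longleftrightarrow>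
    (\<exists>I :: nat \<Rightarrow> 'v set.
       (\<forall>m\<in>{1..n}. I m \<subseteq> ker_pow V T m) \<and>
       B = (\<Union>m\<in>{1..n}. I m) \<and>
       (\<forall>m\<in>{1..n}. represents_basis V T m (I m)))"
proof -
  interpret nilpotent_operator V T n
    using assms(2-4) by (simp add: nilpotent_operator_def)
  show ?thesis
  proof
    assume "min_weight_q_basis V T B"
    then have B: "q_basis V T B" and lt: "\<forall>m<n. card (B \<inter> ker_pow V T m) = level_dim m"
      by (auto simp: min_weight_iff)
    \<comment> \<open>At \<open>n\<close> the equality holds for every \<open>q\<close>-basis: K_n
      is all of \<open>V\<close>, and \<open>card B\<close> is the dimension of the
      cokernel.\<close>
    have "card (B \<inter> ker_pow V T n) = level_dim n"
      using B by (auto simp: ker_pow_top q_basis_iff Int_absorb2)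
    with lt have d: "card (B \<inter> ker_pow V T m) = level_dim m" if "m \<le> n" for m
      using that by (cases "m = n") auto
    \<comment> \<open>Finiteness is what turns \<open>card (B \<inter> ker_pow V T 0) = 0\<close>
      into emptiness, as infinite sets also have \<open>card\<close> equal to 0.\<close>
    have "finite B" using B by (simp add: q_basis_iff)
    then have "B \<inter> ker_pow V T 0 = {}" using d[of 0] level_dim_0 by simp
    then show "\<exists>I. (\<forall>m\<in>{1..n}. I m \<subseteq> ker_pow V T m) \<and> B = (\<Union>m\<in>{1..n}. I m)
        \<and> (\<forall>m\<in>{1..n}. represents_basis V T m (I m))"
      using layers_Union[OF assms(5)] represents_basis_layer[OF B d]
      by (intro exI[of _ "\<lambda>m. B \<inter> ker_pow V T m - ker_pow V T (m - 1)"]) auto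
  next
    assume "\<exists>I. (\<forall>m\<in>{1..n}. I m \<subseteq> ker_pow V T m) \<and> B = (\<Union>m\<in>{1..n}. I m)
        \<and> (\<forall>m\<in>{1..n}. represents_basis V T m (I m))"
    then obtain I where "B = (\<Union>m\<in>{1..n}. I m)" "\<And>m. m \<in> {1..n} \<Longrightarrow> represents_basis V T m (I m)"
      by blast
    then show "min_weight_q_basis V T B"
      using represents_basis_family[of I B] by (auto simp: min_weight_iff)
  qed
qed

end
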